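(* Let $G$ be a finite group. Then the following are equivalent for all $n\ge 1$: (i) $\mathcal{P}(G)\cong\mathcal{P}(\mathbb{Z}_n)$ (isomorphism of graphs); (ii) $|E(G)|=|E(\mathbb{Z}_n)|$; (iii) $G\cong\mathbb{Z}_n$ (isomorphism of groups).
   Context: For a finite group $G$, the (undirected) power graph $\mathcal{P}(G)$ is the simple undirected graph with vertex set $G$ in which two distinct elements $g,h$ are adjacent if and only if one of them is a positive power of the other (i.e. $h\in\langle g\rangle$ or $g\in\langle h\rangle$, where $\langle g\rangle$ is the cyclic subgroup generated by $g$). $E(G)$ denotes the edge set of $\mathcal{P}(G)$. $\mathbb{Z}_n$ is the cyclic group of order $n$.
   Formalization: The equivalence of (ii) with (iii), and hence with (i), is stated only for |G| = n; without this it fails, since Z_2×Z_2 and Z_3 both have 3 edges in their power graphs. The equivalence of (i) and (iii) needs no such condition. *)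

theory Defs
  imports "HOL-Algebra.Elementary_Groups"
begin

text \<open>A simple undirected graph is a pair of a vertex set and an edge set, where an edge is the
  two-element set of its end points.\<close>

type_synonym 'v ugraph = "'v set \<times> 'v set set"

definition verts :: "'v ugraph \<Rightarrow> 'v set" where
  "verts \<Gamma> = fst \<Gamma>"

definition edges :: "'v ugraph \<Rightarrow> 'v set set" where
  "edges \<Gamma> = snd \<Gamma>"

definition ugraph_iso :: "'v ugraph \<Rightarrow> 'w ugraph \<Rightarrow> bool" where
  "ugraph_iso \<Gamma> \<Delta> \<longleftrightarrow>
     (\<exists>f. bij_betw f (verts \<Gamma>) (verts \<Delta>) \<and>
          (\<forall>u\<in>verts \<Gamma>. \<forall>v\<in>verts \<Gamma>. {u, v} \<in> edges \<Gamma> \<longleftrightarrow> {f u, f v} \<in> edges \<Delta>))"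

definition is_positive_power :: "('a, 'b) monoid_scheme \<Rightarrow> 'a \<Rightarrow> 'a \<Rightarrow> bool" where
  "is_positive_power G g h \<longleftrightarrow> (\<exists>k::nat. k \<ge> 1 \<and> h = g [^]\<^bsub>G\<^esub> k)"

definition power_graph :: "('a, 'b) monoid_scheme \<Rightarrow> 'a ugraph" where
  "power_graph G =
     (carrier G,
      {{g, h} | g h. g \<in> carrier G \<and> h \<in> carrier G \<and> g \<noteq> h \<and>
                     (is_positive_power G g h \<or> is_positive_power G h g)})"

end

theory Submission
  imports Defs "HOL-Number_Theory.Totient" "HOL-Algebra.Multiplicative_Group"
    "HOL-Algebra.Weak_Morphisms"
begin

text \<open>
  Counting ordered pairs \<open>(g, h)\<close> with \<open>h\<close> in the cyclic group of \<open>g\<close> gives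
  \<open>2 |E(G)| + |G| = \<Sum>\<^sub>g (2 o(g) - \<phi>(o(g)))\<close>, so it suffices that this sum is maximal, among groups of
  order \<open>n\<close>, only at the cyclic group. The induction needs all weights \<open>A d - B \<phi>(d)\<close> with
  \<open>A \<ge> 2 B \<ge> 0\<close> and \<open>A > 0\<close>. Let \<open>p\<close> be the largest prime divisor of \<open>n\<close>. If the weighted sum of \<open>G\<close>
  is at least that of the cyclic group, then averaging yields an element \<open>g\<close> whose cyclic group has
  index less than \<open>p\<close>, which settles \<open>p = 2\<close>. A pigeonhole argument on its cosets shows that it contains every element of
  \<open>p\<close>-power order, so \<open>G\<close> has a cyclic normal Sylow \<open>p\<close>-subgroup \<open>P\<close>. Summing over a coset of \<open>P\<close> turns a
  weight on \<open>G\<close> into another weight of the same family on \<open>G/P\<close>, with a strict loss unless the coset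
  centralizes \<open>P\<close>. By induction \<open>G/P\<close> is cyclic, a generating coset centralizes \<open>P\<close>, and this coset
  contains a generator of \<open>G\<close>.
\<close>

section \<open>Divisor sums of the totient function\<close>

text \<open>Sending \<open>k\<close> to \<open>(gcd k a, gcd k b)\<close> inverts the multiplication
  of a divisor of \<open>a\<close> by a divisor of \<open>b\<close>.\<close>

lemma sum_divisors_mult_coprime:
  fixes f :: "nat \<Rightarrow> 'c :: comm_monoid_add"
  assumes "coprime a b" "a > 0" "b > 0"
  shows "(\<Sum>d | d dvd a * b. f d) = (\<Sum>d | d dvd a. \<Sum>e | e dvd b. f (d * e))"
proof -
  have gcd_left: "gcd (d * e) a = d" if "d dvd a" "e dvd b" for d e
  proof -
    have "coprime a e" using that assms(1) by (meson coprime_divisors dvd_refl)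
    thus ?thesis using that(1) by (simp add: gcd_mult_left_right_cancel gcd_nat.absorb1)
  qed
  have gcd_right: "gcd (d * e) b = e" if "d dvd a" "e dvd b" for d e
  proof -
    have "coprime b d" using that assms(1) by (meson coprime_commute coprime_divisors dvd_refl)
    thus ?thesis using that(2) by (simp add: gcd_mult_left_left_cancel gcd_nat.absorb1)
  qed
  have split: "gcd k a * gcd k b = k" if "k dvd a * b" for k
  proof (rule dvd_antisym)
    have "coprime (gcd k a) (gcd k b)"
      using assms(1) by (meson coprime_divisors gcd_dvd2)
    thus "gcd k a * gcd k b dvd k" by (simp add: divides_mult)
    \<comment> \<open>Since \<open>k\<close> divides \<open>a * k\<close> and \<open>a * b\<close>,
      it divides \<open>a * gcd k b\<close>. It also divides \<open>k * gcd k b\<close>, hence the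
      gcd of both, which is \<open>gcd k a * gcd k b\<close>.\<close>
    have "k dvd k * gcd k b" "k dvd gcd (a * k) (a * b)"
      using that by simp_all
    hence "k dvd gcd (k * gcd k b) (a * gcd k b)"
      unfolding gcd_mult_distrib_nat by simp
    thus "k dvd gcd k a * gcd k b"
      using gcd_mult_distrib_nat[of "gcd k b" k a] by (simp add: mult.commute)
  qed
  have "(\<Sum>d | d dvd a * b. f d) = (\<Sum>(d, e) \<in> {d. d dvd a} \<times> {e. e dvd b}. f (d * e))"
    by (rule sum.reindex_bij_witness[where i = "\<lambda>(d, e). d * e" and j = "\<lambda>k. (gcd k a, gcd k b)"])
       (auto simp: gcd_left gcd_right split intro: mult_dvd_mono)
  also have "\<dots> = (\<Sum>d | d dvd a. \<Sum>e | e dvd b. f (d * e))"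
    using assms by (intro sum.cartesian_product[symmetric])
  finally show ?thesis .
qed

lemma sum_divisors_prime_power_Suc:
  fixes f :: "nat \<Rightarrow> 'c :: comm_monoid_add"
  assumes "prime p"
  shows "(\<Sum>d | d dvd p ^ Suc a. f d) = f (p ^ Suc a) + (\<Sum>d | d dvd p ^ a. f d)"
proof -
  have "p > 1" using assms prime_gt_1_nat by blast
  have "{d. d dvd p ^ Suc a} = insert (p ^ Suc a) {d. d dvd p ^ a}"
    by (auto simp: divides_primepow_nat[OF assms] le_Suc_eq simp del: power_Suc)
  moreover have "\<not> p ^ Suc a dvd p ^ a"
    using \<open>p > 1\<close> power_dvd_imp_le[of p "Suc a" a] by auto
  ultimately show ?thesis
    using \<open>p > 1\<close> by simp
qed

text \<open>The value at \<open>n\<close> is the sum of the element orders of the cyclic group of order \<open>n\<close>.\<close>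

definition ord_sum :: "nat \<Rightarrow> int" where
  "ord_sum n = (\<Sum>d | d dvd n. int (totient d) * int d)"

text \<open>A cyclic group of order \<open>n\<close> has \<open>totient d\<close> elements of each
  order \<open>d\<close> dividing \<open>n\<close>, so this is its sum of
  \<open>totient (ord x)\<close>. It also counts the ordered pairs of elements generating the same
  subgroup.\<close>

definition totient_sq_sum :: "nat \<Rightarrow> int" where
  "totient_sq_sum n = (\<Sum>d | d dvd n. (int (totient d))\<^sup>2)"

lemma ord_sum_mult_coprime:
  assumes "coprime a b" "a > 0" "b > 0"
  shows "ord_sum (a * b) = ord_sum a * ord_sum b"
proof -
  have "totient (d * e) = totient d * totient e" if "d dvd a" "e dvd b" for d e
    using that assms(1) by (meson coprime_divisors totient_mult_coprime)
  thus ?thesis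
    unfolding ord_sum_def sum_divisors_mult_coprime[OF assms] sum_product
    by (intro sum.cong) (auto simp: ac_simps)
qed

lemma totient_sq_sum_mult_coprime:
  assumes "coprime a b" "a > 0" "b > 0"
  shows "totient_sq_sum (a * b) = totient_sq_sum a * totient_sq_sum b"
proof -
  have "totient (d * e) = totient d * totient e" if "d dvd a" "e dvd b" for d e
    using that assms(1) by (meson coprime_divisors totient_mult_coprime)
  thus ?thesis
    unfolding totient_sq_sum_def sum_divisors_mult_coprime[OF assms] sum_product
    by (intro sum.cong) (auto simp: power_mult_distrib)
qed

lemma totient_sq_sum_le_ord_sum: "totient_sq_sum n \<le> ord_sum n"
  unfolding totient_sq_sum_def ord_sum_def power2_eq_square
  by (intro sum_mono mult_left_mono) (auto simp: totient_le)

lemma totient_sq_sum_pos: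
  assumes "n > 0" shows "totient_sq_sum n > 0"
proof -
  have "(int (totient 1))\<^sup>2 \<le> totient_sq_sum n"
    unfolding totient_sq_sum_def using assms by (intro member_le_sum) auto
  thus ?thesis by simp
qed

lemma ord_sum_pos: "n > 0 \<Longrightarrow> ord_sum n > 0"
  using totient_sq_sum_pos[of n] totient_sq_sum_le_ord_sum[of n] by linarith

text \<open>This is the geometric sum \<open>(p ^ (2 * a + 1) + 1) / (p + 1)\<close>, with the
  denominator cleared to stay in the integers.\<close>

lemma ord_sum_prime_power:
  assumes "prime p"
  shows "int (p + 1) * ord_sum (p ^ a) = int p * (int (p ^ a))\<^sup>2 + 1"
proof (induction a)
  case 0
  show ?case by (simp add: ord_sum_def)
next
  case (Suc a)
  have "int (p - 1) = int p - 1" using prime_gt_0_nat[OF assms] by simp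
  hence "ord_sum (p ^ Suc a) = int p ^ a * (int p - 1) * int p ^ Suc a + ord_sum (p ^ a)"
    unfolding ord_sum_def sum_divisors_prime_power_Suc[OF assms] totient_prime_power_Suc[OF assms]
    by simp
  moreover have alg: "(1 + P) * (x * (P - 1) * (P * x) + v) = P * (P * x)\<^sup>2 + 1"
    if "(1 + P) * v = P * x\<^sup>2 + 1" for P x v :: int
    unfolding distrib_left[of "1 + P"] that by (simp add: algebra_simps power2_eq_square)
  ultimately show ?case using Suc alg[of "int p" "ord_sum (p ^ a)" "int p ^ a"] by simp
qed

text \<open>An exact value is required only at the prime 2: for odd \<open>n\<close> the crude
  \<open>totient_sq_sum_le_ord_sum\<close> suffices in the bound below.\<close>

lemma totient_sq_sum_two_power: "3 * totient_sq_sum (2 ^ a) = (2 ^ a)\<^sup>2 + 2"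
proof (induction a)
  case 0
  show ?case by (simp add: totient_sq_sum_def)
next
  case (Suc a)
  have "totient_sq_sum (2 ^ Suc a) = (2 ^ a)\<^sup>2 + totient_sq_sum (2 ^ a)"
    unfolding totient_sq_sum_def sum_divisors_prime_power_Suc[OF two_is_prime_nat]
      totient_prime_power_Suc[OF two_is_prime_nat]
    by simp
  with Suc show ?case by (simp add: power2_eq_square)
qed

section \<open>Lower bounds in terms of the largest prime divisor\<close>

lemma prime_power_cofactor:
  fixes n :: nat
  assumes "prime p" "p dvd n" "n > 0"
  obtains a m where "n = p ^ a * m" "a > 0" "\<not> p dvd m" "coprime (p ^ a) m" "m > 0"
proof -
  obtain m where m: "n = p ^ multiplicity p n * m" "\<not> p dvd m"
    using multiplicity_decompose' assms by (metis neq0_conv not_prime_unit)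
  have "multiplicity p n > 0"
    using assms by (simp add: prime_multiplicity_gt_zero_iff)
  moreover have "coprime (p ^ multiplicity p n) m"
    using m assms by (simp add: prime_imp_coprime)
  moreover have "m > 0" using m assms by (metis gr0I dvd_0_right)
  ultimately show ?thesis using m that by blast
qed

lemma coprime_prime_power_less:
  fixes k :: nat
  assumes "prime p" "0 < k" "k < p"
  shows "coprime (p ^ a) k"
  using prime_imp_coprime[OF assms(1)] nat_dvd_not_less[OF assms(2,3)] by simp

text \<open>Peeling off the largest prime \<open>p\<close> gains the factor \<open>p / (p + 1)\<close>; these factors telescope because
  the remaining primes are at most \<open>p - 1\<close>.\<close>

lemma ord_sum_lower_bound:
  assumes "n > 0" "s \<le> t + 1" "\<And>r. prime r \<Longrightarrow> r dvd n \<Longrightarrow> s \<le> r \<and> r \<le> t"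
  shows "int s * (int n)\<^sup>2 \<le> int (t + 1) * ord_sum n"
  using assms
proof (induction t arbitrary: n)
  case 0
  have "n = 1"
  proof (rule ccontr)
    assume "n \<noteq> 1"
    then obtain r where "prime r" "r dvd n" using prime_factor_nat by blast
    with 0(3)[of r] show False using prime_gt_0_nat[of r] by simp
  qed
  thus ?case using 0 by (simp add: ord_sum_def)
next
  case (Suc t)
  show ?case
  proof (cases "s \<le> t + 1")
    \<comment> \<open>Here the range of admissible primes is empty, which forces
      \<open>n = 1\<close> and makes the bound an equality.\<close>
    case False
    with Suc.prems have "s = t + 2" by simp
    have "n = 1"
    proof (rule ccontr)
      assume "n \<noteq> 1"
      then obtain r where "prime r" "r dvd n" using prime_factor_nat by blast
      with Suc.prems(3)[of r] \<open>s = t + 2\<close> show False by linarith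
    qed
    thus ?thesis using \<open>s = t + 2\<close> by (simp add: ord_sum_def)
  next
    case st: True
    show ?thesis
    proof (cases "prime (Suc t) \<and> Suc t dvd n")
      case True
      define p where "p = Suc t"
      have p: "prime p" "p dvd n" using True p_def by auto
      obtain a m where am: "n = p ^ a * m" "a > 0" "\<not> p dvd m" "coprime (p ^ a) m" "m > 0"
        using prime_power_cofactor[OF p Suc.prems(1)] .
      have "s \<le> r \<and> r \<le> t" if "prime r" "r dvd m" for r
      proof -
        have "r \<noteq> p" using that am by auto
        thus ?thesis using Suc.prems(3)[of r] that am p_def by auto
      qed
      hence IH: "int s * (int m)\<^sup>2 \<le> int p * ord_sum m"
        using Suc.IH[OF am(5) st] p_def by simp
      have pos: "p ^ a > 0" using prime_gt_0_nat[OF p(1)] by simp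
      have "int s * (int n)\<^sup>2 = (int s * (int m)\<^sup>2) * (int (p ^ a))\<^sup>2"
        using am by (simp add: power_mult_distrib)
      also have "\<dots> \<le> (int p * ord_sum m) * (int (p ^ a))\<^sup>2"
        by (intro mult_right_mono IH) auto
      also have "\<dots> \<le> ord_sum m * (int (p + 1) * ord_sum (p ^ a))"
        unfolding ord_sum_prime_power[OF p(1)] using ord_sum_pos[OF am(5)]
        by (simp add: algebra_simps)
      also have "\<dots> = int (p + 1) * ord_sum n"
        using am pos by (simp add: ord_sum_mult_coprime)
      finally show ?thesis by (simp add: p_def)
    next
      case False
      have "s \<le> r \<and> r \<le> t" if "prime r" "r dvd n" for r
        using Suc.prems(3)[of r] that False by (metis le_Suc_eq)
      hence "int s * (int n)\<^sup>2 \<le> int (t + 1) * ord_sum n"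
        using Suc.IH[OF Suc.prems(1) st] by simp
      also have "\<dots> \<le> int (Suc t + 1) * ord_sum n"
        using ord_sum_pos[OF Suc.prems(1)] by (intro mult_right_mono) auto
      finally show ?thesis .
    qed
  qed
qed

text \<open>The mean of \<open>2 * ord x - totient (ord x)\<close> over the cyclic group is thus at
  least \<open>2 * n / p\<close>. For odd \<open>n\<close> the primes start at 3, so
  \<open>ord_sum n\<close> is at least \<open>3 * n^2 / (p + 1)\<close>, which is enough. For even
  \<open>n\<close> the numerator drops to 2, but the factor 2 of \<open>n\<close> makes
  \<open>totient_sq_sum n\<close> at most two thirds of \<open>ord_sum n\<close>; this compensates
  once \<open>p \<ge> 3\<close>. For \<open>p = 2\<close> equality holds.\<close>

lemma ord_sum_totient_sq_sum_bound:
  assumes "n > 1" "prime p" "p dvd n" and max: "\<And>r. prime r \<Longrightarrow> r dvd n \<Longrightarrow> r \<le> p"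
  shows "2 * (int n)\<^sup>2 \<le> int p * (2 * ord_sum n - totient_sq_sum n)"
proof (cases "even n")
  case False
  have "3 \<le> r" if "prime r" "r dvd n" for r
  proof -
    have "r \<noteq> 2" using that False by auto
    thus ?thesis using prime_ge_2_nat[OF that(1)] by simp
  qed
  hence ge3: "3 \<le> r \<and> r \<le> p" if "prime r" "r dvd n" for r
    using that max by blast
  hence "p \<ge> 3" using assms by blast
  have "int 3 * (int n)\<^sup>2 \<le> int (p + 1) * ord_sum n"
    using ord_sum_lower_bound[of n 3 p, OF _ _ ge3] \<open>p \<ge> 3\<close> assms(1) by simp
  hence *: "3 * (int n)\<^sup>2 \<le> int (p + 1) * ord_sum n" by simp
  have "int (p + 1) * (2 * (int n)\<^sup>2) = 2 * int (p + 1) * (int n)\<^sup>2" by simp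
  also have "\<dots> \<le> 3 * int p * (int n)\<^sup>2" using \<open>p \<ge> 3\<close> by (intro mult_right_mono) auto
  also have "\<dots> = int p * (3 * (int n)\<^sup>2)" by simp
  also have "\<dots> \<le> int p * (int (p + 1) * ord_sum n)" by (intro mult_left_mono *) auto
  also have "\<dots> \<le> int p * (int (p + 1) * (2 * ord_sum n - totient_sq_sum n))"
    using totient_sq_sum_le_ord_sum[of n] by (intro mult_left_mono) auto
  also have "\<dots> = int (p + 1) * (int p * (2 * ord_sum n - totient_sq_sum n))" by simp
  finally show ?thesis by (rule mult_left_le_imp_le) simp
next
  case True
  obtain a m where am: "n = 2 ^ a * m" "a > 0" "\<not> 2 dvd m" "coprime (2 ^ a) m" "m > 0"
    using prime_power_cofactor[OF two_is_prime_nat True] assms(1) by auto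
  have ord: "ord_sum n = ord_sum (2 ^ a) * ord_sum m"
    and tot: "totient_sq_sum n = totient_sq_sum (2 ^ a) * totient_sq_sum m"
    using am by (simp_all add: ord_sum_mult_coprime totient_sq_sum_mult_coprime)
  have two: "3 * ord_sum (2 ^ a) = 2 * (2 ^ a)\<^sup>2 + 1"
    using ord_sum_prime_power[OF two_is_prime_nat, of a] by simp
  show ?thesis
  proof (cases "p = 2")
    case True
    have "m = 1"
    proof (rule ccontr)
      assume "m \<noteq> 1"
      then obtain r where r: "prime r" "r dvd m" using prime_factor_nat by blast
      hence "r \<le> 2" using max[of r] am True by auto
      hence "r = 2" using prime_ge_2_nat[OF r(1)] by simp
      thus False using r am by simp
    qed
    hence "2 * ord_sum n - totient_sq_sum n = (int n)\<^sup>2"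
      using two totient_sq_sum_two_power[of a] am by simp
    thus ?thesis using True by simp
  next
    case False
    hence "p \<ge> 3" using prime_ge_2_nat[OF assms(2)] by simp
    have "int 2 * (int n)\<^sup>2 \<le> int (p + 1) * ord_sum n"
      using ord_sum_lower_bound[of n 2 p] assms(1) max prime_ge_2_nat \<open>p \<ge> 3\<close> by simp
    hence *: "2 * (int n)\<^sup>2 \<le> int (p + 1) * ord_sum n" by simp
    \<comment> \<open>By the closed forms, the ratio 2/3 at \<open>2 ^ a\<close> amounts to
      \<open>4 \<le> 4 ^ a\<close>, that is to \<open>a > 0\<close>.\<close>
    have "(2::int) \<le> 2 ^ a" using am(2) by (cases a) auto
    hence "(2::int)\<^sup>2 \<le> (2 ^ a)\<^sup>2" by (intro power_mono) auto
    hence "3 * totient_sq_sum (2 ^ a) \<le> 2 * ord_sum (2 ^ a)"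
      using two totient_sq_sum_two_power[of a] by simp
    hence "3 * totient_sq_sum (2 ^ a) * totient_sq_sum m \<le> 2 * ord_sum (2 ^ a) * ord_sum m"
      by (rule mult_mono[OF _ totient_sq_sum_le_ord_sum])
        (use totient_sq_sum_pos[OF am(5)] ord_sum_pos[of "2 ^ a"] in auto)
    hence **: "4 * ord_sum n \<le> 3 * (2 * ord_sum n - totient_sq_sum n)"
      using ord tot by (simp add: mult_ac)
    have "3 * int (p + 1) * (2 * (int n)\<^sup>2) = 6 * int (p + 1) * (int n)\<^sup>2" by simp
    also have "\<dots> \<le> 8 * int p * (int n)\<^sup>2" using \<open>p \<ge> 3\<close> by (intro mult_right_mono) auto
    also have "\<dots> = 4 * int p * (2 * (int n)\<^sup>2)" by simp
    also have "\<dots> \<le> 4 * int p * (int (p + 1) * ord_sum n)" by (intro mult_left_mono *) auto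
    also have "\<dots> = int p * int (p + 1) * (4 * ord_sum n)" by simp
    also have "\<dots> \<le> int p * int (p + 1) * (3 * (2 * ord_sum n - totient_sq_sum n))"
      by (intro mult_left_mono **) auto
    also have "\<dots> = 3 * int (p + 1) * (int p * (2 * ord_sum n - totient_sq_sum n))"
      by (simp add: algebra_simps)
    finally show ?thesis by (rule mult_left_le_imp_le) simp
  qed
qed

section \<open>Elements of large order\<close>

text \<open>Edges are counted by \<open>A = 2\<close>, \<open>B = 1\<close>. Two parameters are kept
  because passing to the quotient multiplies them by different factors, \<open>ord_sum q\<close> and
  \<open>totient_sq_sum q\<close>.\<close>

definition ord_weight :: "int \<Rightarrow> int \<Rightarrow> nat \<Rightarrow> int" where
  "ord_weight A B d = A * int d - B * int (totient d)"

lemma sum_divisors_ord_weight: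
  "(\<Sum>d | d dvd n. int (totient d) * ord_weight A B d) = A * ord_sum n - B * totient_sq_sum n"
  unfolding ord_weight_def ord_sum_def totient_sq_sum_def sum_distrib_left sum_subtractf[symmetric]
  by (intro sum.cong) (auto simp: algebra_simps power2_eq_square)

lemma ord_weight_nonneg:
  assumes "0 \<le> B" "2 * B \<le> A"
  shows "0 \<le> ord_weight A B d"
proof -
  have "B * int (totient d) \<le> A * int d"
    using assms by (intro mult_mono) (auto simp: totient_le)
  thus ?thesis by (simp add: ord_weight_def)
qed

text \<open>The argument \<open>n div gcd k n\<close> is the order of the \<open>k\<close>-th power
  of an element of order \<open>n\<close>. Exactly \<open>totient (n div d)\<close> exponents
  \<open>k\<close> have \<open>gcd k n = d\<close>.\<close>

lemma sum_div_gcd: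
  fixes f :: "nat \<Rightarrow> int"
  assumes "n > 0"
  shows "(\<Sum>k\<in>{0<..n}. f (n div gcd k n)) = (\<Sum>d | d dvd n. int (totient d) * f d)"
proof -
  have "(\<Sum>k\<in>{0<..n}. f (n div gcd k n)) =
      (\<Sum>d | d dvd n. \<Sum>k | k \<in> {0<..n} \<and> gcd k n = d. f (n div gcd k n))"
    using assms by (intro sum.group[symmetric]) auto
  also have "\<dots> = (\<Sum>d | d dvd n. int (totient (n div d)) * f (n div d))"
  proof (rule sum.cong[OF refl])
    fix d assume "d \<in> {d. d dvd n}"
    hence "card {k \<in> {0<..n}. gcd k n = d} = totient (n div d)"
      using card_gcd_eq_totient[OF assms] by simp
    moreover have "(\<Sum>k | k \<in> {0<..n} \<and> gcd k n = d. f (n div gcd k n)) =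
        (\<Sum>k | k \<in> {0<..n} \<and> gcd k n = d. f (n div d))"
      by (intro sum.cong) auto
    ultimately show "(\<Sum>k | k \<in> {0<..n} \<and> gcd k n = d. f (n div gcd k n)) =
        int (totient (n div d)) * f (n div d)"
      by simp
  qed
  also have "\<dots> = (\<Sum>d | d dvd n. int (totient d) * f d)"
    using assms
    by (intro sum.reindex_bij_witness[of _ "(div) n" "(div) n"]) (auto elim: dvdE)
  finally show ?thesis .
qed

section \<open>Cyclic subgroups and power maps in a finite group\<close>

context group
begin

text \<open>The exponents run from 1 to \<open>ord y\<close>, not from 0, to match both
  \<open>sum_div_gcd\<close> and the positive powers in the power graph.\<close>

lemma generate_eq_image_pow:
  assumes "finite (carrier G)" "y \<in> carrier G"
  shows "generate G {y} = (\<lambda>k::nat. y [^] k) ` {0<..ord y}"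
proof
  show "generate G {y} \<subseteq> (\<lambda>k::nat. y [^] k) ` {0<..ord y}"
  proof
    fix u assume "u \<in> generate G {y}"
    then obtain k :: nat where k: "u = y [^] k"
      using generate_pow_on_finite_carrier[OF assms] by blast
    have pos: "ord y > 0" using ord_ge_1[OF assms] by simp
    \<comment> \<open>The residue 0 lies outside the range and is represented by
      \<open>ord y\<close>.\<close>
    define j where "j = (if k mod ord y = 0 then ord y else k mod ord y)"
    have "j mod ord y = k mod ord y" by (simp add: j_def)
    hence "int (ord y) dvd int j - int k"
      by (metis mod_eq_dvd_iff of_nat_mod)
    hence "y [^] int k = y [^] int j" using assms(2) by (simp add: int_pow_eq)
    hence "u = y [^] j" using k by (simp add: int_pow_int)
    moreover have "j \<in> {0<..ord y}" using pos by (auto simp: j_def less_imp_le)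
    ultimately show "u \<in> (\<lambda>k::nat. y [^] k) ` {0<..ord y}" by blast
  qed
qed (use generate_pow_on_finite_carrier[OF assms] in blast)

lemma sum_generate_ord:
  fixes f :: "nat \<Rightarrow> int"
  assumes "finite (carrier G)" "y \<in> carrier G"
  shows "(\<Sum>u\<in>generate G {y}. f (ord u)) = (\<Sum>d | d dvd ord y. int (totient d) * f d)"
proof -
  have pos: "ord y > 0" using ord_ge_1[OF assms] by simp
  have "inj_on (\<lambda>k::nat. y [^] k) {0<..ord y}"
    using ord_inj'[OF assms(2)] by (rule inj_on_subset) auto
  hence "(\<Sum>u\<in>generate G {y}. f (ord u)) = (\<Sum>k\<in>{0<..ord y}. f (ord (y [^] k)))"
    unfolding generate_eq_image_pow[OF assms] by (simp add: sum.reindex)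
  also have "\<dots> = (\<Sum>k\<in>{0<..ord y}. f (ord y div gcd k (ord y)))"
    using assms(2) by (intro sum.cong) (auto simp: ord_pow_gen gcd.commute)
  finally show ?thesis using sum_div_gcd[OF pos] by simp
qed

text \<open>Otherwise every order is at most \<open>n / p\<close> and, as the totient is at least 1,
  every weight at most \<open>A * n / p - B\<close>. The total then falls below the value of the
  cyclic group by \<open>ord_sum_totient_sq_sum_bound\<close>.\<close>

lemma exists_large_ord:
  assumes "finite (carrier G)" "order G > 1"
    and "prime p" "p dvd order G" "\<And>r. prime r \<Longrightarrow> r dvd order G \<Longrightarrow> r \<le> p"
    and "0 < A" "0 \<le> B" "2 * B \<le> A"
    and "A * ord_sum (order G) - B * totient_sq_sum (order G)
           \<le> (\<Sum>x\<in>carrier G. ord_weight A B (ord x))"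
  shows "\<exists>g\<in>carrier G. order G < p * ord g"
proof (rule ccontr)
  assume neg: "\<not> ?thesis"
  define n where "n = order G"
  define \<psi> where "\<psi> = ord_sum n"
  define \<Phi> where "\<Phi> = totient_sq_sum n"
  have "n > 0" using assms(2) n_def by simp
  have "p > 0" using assms(3) prime_gt_0_nat by blast
  have le: "int p * ord_weight A B (ord x) \<le> A * int n - B * int p" if "x \<in> carrier G" for x
  proof -
    have "p * ord x \<le> n" using neg that n_def by (meson not_le)
    hence "int p * int (ord x) \<le> int n" by (simp flip: of_nat_mult)
    hence "A * (int p * int (ord x)) \<le> A * int n" using assms(6) by (intro mult_left_mono) auto
    moreover have "int (totient (ord x)) \<ge> 1"
      using ord_ge_1[OF assms(1) that] totient_gt_0_iff[of "ord x"] by linarith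
    hence "B * int p * 1 \<le> B * int p * int (totient (ord x))"
      using assms(7) by (intro mult_left_mono) auto
    ultimately show ?thesis by (simp add: ord_weight_def algebra_simps)
  qed
  have "int p * (A * \<psi> - B * \<Phi>) \<le> int p * (\<Sum>x\<in>carrier G. ord_weight A B (ord x))"
    using assms(9) by (intro mult_left_mono) (auto simp: n_def \<psi>_def \<Phi>_def)
  also have "\<dots> \<le> (\<Sum>x\<in>carrier G. A * int n - B * int p)"
    unfolding sum_distrib_left by (intro sum_mono le)
  also have "\<dots> = int n * (A * int n - B * int p)" by (simp add: n_def order_def)
  finally have upper: "int p * (A * \<psi> - B * \<Phi>) \<le> int n * (A * int n - B * int p)" .
  have bound: "2 * (int n)\<^sup>2 \<le> int p * (2 * \<psi> - \<Phi>)"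
    unfolding \<psi>_def \<Phi>_def n_def using ord_sum_totient_sq_sum_bound assms(2-5) by blast
  moreover have "int p * \<Phi> > 0"
    using \<open>p > 0\<close> totient_sq_sum_pos[OF \<open>n > 0\<close>] by (simp add: \<Phi>_def)
  ultimately have gt: "(int n)\<^sup>2 < int p * \<psi>" by (simp add: algebra_simps)
  \<comment> \<open>Writing \<open>A\<close> as \<open>(A - 2 * B) + 2 * B\<close> splits the
    difference of the two sides of \<open>upper\<close> into three terms of one sign. The strict one
    is the first if \<open>B = 0\<close>, and the last otherwise.\<close>
  have "0 \<le> (A - 2 * B) * (int p * \<psi> - (int n)\<^sup>2)"
    "0 \<le> B * (int p * (2 * \<psi> - \<Phi>) - 2 * (int n)\<^sup>2)" "0 \<le> B * int p * int n"
    using gt bound assms by auto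
  moreover have "0 < (A - 2 * B) * (int p * \<psi> - (int n)\<^sup>2) \<or> 0 < B * int p * int n"
    using gt assms(6-8) \<open>p > 0\<close> \<open>n > 0\<close> by (cases "B = 0") auto
  moreover have "int n * (A * int n - B * int p) - int p * (A * \<psi> - B * \<Phi>) =
    - ((A - 2 * B) * (int p * \<psi> - (int n)\<^sup>2) + B * (int p * (2 * \<psi> - \<Phi>) - 2 * (int n)\<^sup>2)
       + B * int p * int n)"
    by (simp add: algebra_simps power2_eq_square)
  ultimately show False using upper by linarith
qed

text \<open>The \<open>p\<close> cosets of \<open>H\<close> represented by the powers of
  \<open>h\<close> with exponents below \<open>p\<close> are too large to be pairwise disjoint. Two
  powers in a common coset differ by an element of \<open>H\<close>.\<close>

lemma exists_pow_in_subgroup: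
  assumes "finite (carrier G)" "subgroup H G" "h \<in> carrier G" "order G < p * card H"
  shows "\<exists>k::nat. 0 < k \<and> k < p \<and> h [^] k \<in> H"
proof -
  interpret subgroup H G by fact
  let ?f = "\<lambda>(i::nat, z). h [^] i \<otimes> z"
  have "?f ` ({..<p} \<times> H) \<subseteq> carrier G" using assms(3) subset by auto
  hence "card (?f ` ({..<p} \<times> H)) \<le> order G"
    unfolding order_def using assms(1) by (rule card_mono[rotated])
  hence "\<not> inj_on ?f ({..<p} \<times> H)"
    using assms(4) by (metis card_image card_cartesian_product card_lessThan not_le)
  then obtain i z j w where *: "i < p" "j < p" "z \<in> H" "w \<in> H" "(i, z) \<noteq> (j, w)"
      "h [^] i \<otimes> z = h [^] j \<otimes> w"
    by (auto simp: inj_on_def)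
  have aux: "h [^] (j - i) \<in> H" "i \<noteq> j"
    if "i \<le> j" "z \<in> H" "w \<in> H" "(i, z) \<noteq> (j, w)" "h [^] i \<otimes> z = h [^] j \<otimes> w" for i j :: nat and z w
  proof -
    have car: "z \<in> carrier G" "w \<in> carrier G" using that subset by auto
    have "h [^] j = h [^] i \<otimes> h [^] (j - i)"
      using that(1) assms(3) by (simp add: nat_pow_mult)
    hence eq: "z = h [^] (j - i) \<otimes> w"
      using that(5) assms(3) car by (simp add: m_assoc)
    hence "h [^] (j - i) = z \<otimes> inv w"
      using assms(3) car by (simp add: m_assoc)
    thus "h [^] (j - i) \<in> H" using that by simp
    show "i \<noteq> j" using eq that car by auto
  qed
  show ?thesis
  proof (cases "i \<le> j")
    case True
    with aux[OF True *(3-6)] *(2) show ?thesis by (intro exI[of _ "j - i"]) simp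
  next
    case False
    hence "j \<le> i" by simp
    with aux[OF _ *(4,3) _ *(6)[symmetric]] *(1,5) False show ?thesis
      by (intro exI[of _ "i - j"]) auto
  qed
qed

text \<open>Take \<open>e\<close> inverse to \<open>d\<close> modulo \<open>q\<close>. One
  \<open>e\<close> serves all \<open>x\<close>, so the \<open>d\<close>-th power is injective on the
  solutions of \<open>x [^] q = \<one>\<close>.\<close>

lemma pow_coprime_inverse:
  assumes "coprime (d::nat) q"
  shows "\<exists>e::nat. \<forall>x\<in>carrier G. x [^] q = \<one> \<longrightarrow> (x [^] d) [^] e = x"
proof -
  obtain e where e: "[d * e = 1] (mod q)"
    using cong_solve_coprime_nat[OF assms] by auto
  have "(x [^] d) [^] e = x" if "x \<in> carrier G" "x [^] q = \<one>" for x
  proof -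
    have "int (ord x) dvd int q" using that by (simp add: pow_eq_id)
    moreover have "int q dvd int 1 - int (d * e)"
      using e by (metis cong_int_iff cong_iff_dvd_diff cong_sym_eq)
    ultimately have "x [^] int (d * e) = x [^] int 1"
      using that(1) by (subst int_pow_eq) (auto intro: dvd_trans)
    hence "x [^] (d * e) = x [^] (1::nat)" unfolding int_pow_int .
    thus ?thesis using that(1) by (simp add: nat_pow_pow)
  qed
  thus ?thesis by blast
qed

text \<open>The index of the group of \<open>g\<close> is less than \<open>p\<close>, hence prime to
  \<open>p\<close>, so \<open>p ^ a\<close> divides \<open>ord g\<close> and a power
  \<open>y\<close> of \<open>g\<close> has order \<open>p ^ a\<close>.\<close>

lemma cyclic_normal_sylow:
  assumes "finite (carrier G)" "prime p" "order G = p ^ a * m" "g \<in> carrier G"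
    and "order G < p * ord g"
  obtains y where "y \<in> carrier G" "ord y = p ^ a" "generate G {y} \<lhd> G"
proof -
  define q where "q = p ^ a"
  have "p > 0" using assms(2) prime_gt_0_nat by blast
  hence "q > 0" by (simp add: q_def)
  obtain i where i: "order G = ord g * i"
    using ord_dvd_group_order[OF assms(4)] by blast
  have "i > 0" using i assms(1) order_gt_0_iff_finite by (metis gr0I mult_0_right less_irrefl)
  have "i < p" using assms(5) i by (simp add: mult.commute)
  hence "coprime q i"
    using coprime_prime_power_less[OF assms(2) \<open>i > 0\<close> \<open>i < p\<close>] by (simp add: q_def)
  moreover have "q dvd ord g * i" using i assms(3) q_def by (metis dvd_triv_left)
  ultimately have "q dvd ord g" by (simp add: coprime_dvd_mult_left_iff)
  then obtain l where l: "ord g = q * l" by blast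
  have "l > 0" using l ord_ge_1[OF assms(1,4)] by (metis gr0I mult_0_right not_one_le_zero)
  define y where "y = g [^] l"
  have y: "y \<in> carrier G" "ord y = q"
    using assms(4) l \<open>l > 0\<close> by (auto simp: y_def ord_pow)
  have sub: "subgroup (generate G {y}) G"
    using y by (intro generate_is_subgroup) auto
  \<comment> \<open>Normality follows from this description, because conjugation preserves the
    equation \<open>h [^] q = \<one>\<close>.\<close>
  have torsion: "generate G {y} = {h \<in> carrier G. h [^] q = \<one>}"
  proof (intro equalityI subsetI CollectI conjI)
    fix h assume h: "h \<in> generate G {y}"
    thus "h \<in> carrier G" using y generate_incl by blast
    obtain k :: nat where "h = y [^] k"
      using h generate_pow_on_finite_carrier[OF assms(1) y(1)] by blast
    thus "h [^] q = \<one>" using y pow_ord_eq_1[OF y(1)]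
      by (metis nat_pow_one nat_pow_pow mult.commute)
  next
    fix h assume "h \<in> {h \<in> carrier G. h [^] q = \<one>}"
    hence h: "h \<in> carrier G" "h [^] q = \<one>" by auto
    have gsub: "subgroup (generate G {g}) G"
      using assms(4) by (intro generate_is_subgroup) auto
    \<comment> \<open>A power of \<open>h\<close> with exponent prime to \<open>p\<close> lies in
      the group of \<open>g\<close>. Undoing that exponent modulo \<open>q\<close> puts
      \<open>h\<close> itself there.\<close>
    obtain k :: nat where k: "0 < k" "k < p" "h [^] k \<in> generate G {g}"
      using exists_pow_in_subgroup[OF assms(1) gsub h(1)] assms(5)
        generate_pow_card[OF assms(4)] by auto
    have cop: "coprime k q"
      using k assms(2) coprime_prime_power_less[of p k a] by (simp add: q_def coprime_commute)
    obtain e :: nat where e: "(h [^] k) [^] e = h"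
      using pow_coprime_inverse[OF cop] h by blast
    obtain b :: nat where b: "h [^] k = g [^] b"
      using k generate_pow_on_finite_carrier[OF assms(1,4)] by blast
    have hg: "h = g [^] (b * e)" using e unfolding b by (simp add: nat_pow_pow assms(4))
    hence "g [^] (b * e * q) = \<one>" using h assms(4) by (simp add: nat_pow_pow)
    hence "q * l dvd b * e * q" using assms(4) l by (simp add: pow_eq_id)
    hence "l dvd b * e" using \<open>q > 0\<close> by (simp add: mult.commute[of _ q])
    then obtain c where "b * e = l * c" by blast
    hence "h = y [^] c" using hg assms(4) by (simp add: y_def nat_pow_pow)
    thus "h \<in> generate G {y}"
      using generate_pow_on_finite_carrier[OF assms(1) y(1)] by blast
  qed
  have conj_pow: "(x \<otimes> h \<otimes> inv x) [^] k = x \<otimes> h [^] k \<otimes> inv x"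
    if "x \<in> carrier G" "h \<in> carrier G" for x h and k :: nat
  proof (induction k)
    case (Suc k)
    have "inv x \<otimes> (x \<otimes> (h \<otimes> inv x)) = h \<otimes> inv x"
      using that by (simp flip: m_assoc)
    with Suc show ?case using that by (simp add: m_assoc)
  qed (use that in simp)
  have "x \<otimes> h \<otimes> inv x \<in> generate G {y}" if "x \<in> carrier G" "h \<in> generate G {y}" for x h
    using that unfolding torsion by (auto simp: conj_pow)
  hence "generate G {y} \<lhd> G" using sub by (simp add: normal_inv_iff)
  thus ?thesis using that y q_def by blast
qed

end

section \<open>Passing to the quotient by a cyclic normal Sylow subgroup\<close>

text \<open>Fixing a generator \<open>y\<close>, not just the subgroup, turns centralizing the
  subgroup into the single equation \<open>y \<otimes> z = z \<otimes> y\<close>.\<close>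

locale cyclic_normal_hall_subgroup = group G for G (structure) +
  fixes y :: 'a and q m :: nat
  assumes fin: "finite (carrier G)"
    and y_carrier: "y \<in> carrier G"
    and ord_y: "ord y = q"
    and normal_generate: "generate G {y} \<lhd> G"
    and order_eq: "order G = q * m"
    and coprime_q_m: "coprime q m"
begin

abbreviation "P \<equiv> generate G {y}"

sublocale P: normal P G
  by (rule normal_generate)

sublocale Q: group "G Mod P"
  by (rule P.factorgroup_is_group)

abbreviation "quotient_ord z \<equiv> Q.ord (P #> z)"

lemma q_pos: "q > 0"
  using ord_ge_1[OF fin y_carrier] ord_y by simp

lemma card_P: "card P = q"
  using generate_pow_card[OF y_carrier] ord_y by simp

lemma finite_P: "finite P"
  using P.subset fin finite_subset by blast

lemma order_quotient: "order (G Mod P) = m"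
proof -
  have "card (rcosets P) * q = m * q"
    using lagrange[OF P.subgroup_axioms] card_P order_eq by (simp add: mult.commute)
  thus ?thesis using q_pos by (simp add: order_def FactGroup_def)
qed

lemma finite_quotient: "finite (carrier (G Mod P))"
  using fin by (simp add: carrier_FactGroup)

lemma rcos_in_quotient: "z \<in> carrier G \<Longrightarrow> P #> z \<in> carrier (G Mod P)"
  by (simp add: carrier_FactGroup)

lemma quotient_ord_dvd:
  assumes "z \<in> carrier G"
  shows "quotient_ord z dvd m"
  using Q.ord_dvd_group_order[OF rcos_in_quotient[OF assms]] order_quotient by simp

lemma quotient_ord_pos:
  assumes "z \<in> carrier G"
  shows "quotient_ord z > 0"
  using Q.ord_ge_1[OF finite_quotient rcos_in_quotient[OF assms]] by simp

lemma coprime_quotient_ord: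
  assumes "z \<in> carrier G"
  shows "coprime (quotient_ord z) q"
  using coprime_q_m quotient_ord_dvd[OF assms]
  by (meson coprime_commute coprime_divisors dvd_refl)

lemma pow_in_P_iff:
  fixes k :: nat
  assumes "z \<in> carrier G"
  shows "z [^] k \<in> P \<longleftrightarrow> quotient_ord z dvd k"
proof -
  have "z [^] k \<in> P \<longleftrightarrow> P #> (z [^] k) = P"
    using coset_join1[OF _ nat_pow_closed[OF assms] P.subgroup_axioms]
      coset_join2[OF nat_pow_closed[OF assms] P.subgroup_axioms] by auto
  also have "\<dots> \<longleftrightarrow> (P #> z) [^]\<^bsub>G Mod P\<^esub> k = \<one>\<^bsub>G Mod P\<^esub>"
    by (simp add: P.FactGroup_pow[OF assms])
  also have "\<dots> \<longleftrightarrow> quotient_ord z dvd k"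
    by (rule Q.pow_eq_id[OF rcos_in_quotient[OF assms]])
  finally show ?thesis .
qed

lemma ord_eq_quotient_ord_mult:
  assumes "z \<in> carrier G"
  shows "ord z = quotient_ord z * ord (z [^] quotient_ord z)"
proof -
  have "quotient_ord z dvd ord z"
    using pow_in_P_iff[OF assms, of "ord z"] assms P.one_closed by simp
  thus ?thesis using ord_pow[OF assms] quotient_ord_pos[OF assms] by simp
qed

lemma P_pow_q:
  assumes "u \<in> P"
  shows "u [^] q = \<one>"
proof -
  obtain k :: nat where "u = y [^] k"
    using assms generate_pow_on_finite_carrier[OF fin y_carrier] by blast
  hence "u [^] q = (y [^] q) [^] k" using y_carrier by (simp add: nat_pow_pow mult.commute)
  thus ?thesis using pow_ord_eq_1[OF y_carrier] ord_y by simp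
qed

lemma commutes_P:
  assumes "u \<in> P" "z \<in> carrier G" "y \<otimes> z = z \<otimes> y"
  shows "u \<otimes> z = z \<otimes> u"
proof -
  obtain k :: nat where "u = y [^] k"
    using assms generate_pow_on_finite_carrier[OF fin y_carrier] by blast
  thus ?thesis using group_commutes_pow[OF assms(3) y_carrier assms(2)] by simp
qed

lemma rcos_eq:
  assumes "z \<in> carrier G" "x \<in> P #> z"
  shows "x \<in> carrier G" "P #> x = P #> z"
  using assms(2) r_coset_subset_G[OF P.subset assms(1)] repr_independence[OF assms(2,1) P.subgroup_axioms]
  by blast+

text \<open>With \<open>d\<close> the order of the coset, centrality gives
  \<open>(u \<otimes> z) [^] d = u [^] d \<otimes> z [^] d\<close> for \<open>u\<close> in
  \<open>P\<close>, and the \<open>d\<close>-th power is injective on \<open>P\<close> because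
  \<open>d\<close> is prime to \<open>q\<close>. The values lie in \<open>P\<close>, which has the
  size of the coset.\<close>

lemma bij_betw_pow_coset:
  assumes "z \<in> carrier G" "y \<otimes> z = z \<otimes> y"
  shows "bij_betw (\<lambda>x. x [^] quotient_ord z) (P #> z) P"
proof -
  let ?d = "quotient_ord z"
  obtain e :: nat where e: "\<forall>x\<in>carrier G. x [^] q = \<one> \<longrightarrow> (x [^] ?d) [^] e = x"
    using pow_coprime_inverse[OF coprime_quotient_ord[OF assms(1)]] by blast
  have "inj_on (\<lambda>x. x [^] ?d) (P #> z)"
  proof (rule inj_onI)
    fix x x' assume "x \<in> P #> z" "x' \<in> P #> z" and eq: "x [^] ?d = x' [^] ?d"
    then obtain u u' where u: "u \<in> P" "x = u \<otimes> z" and u': "u' \<in> P" "x' = u' \<otimes> z"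
      by (auto simp: r_coset_def)
    have car: "u \<in> carrier G" "u' \<in> carrier G" using u u' P.subset by auto
    have "u [^] ?d \<otimes> z [^] ?d = u' [^] ?d \<otimes> z [^] ?d"
      using eq u u' car assms(1) pow_mult_distrib[OF commutes_P[OF _ assms]] by metis
    hence "u [^] ?d = u' [^] ?d" using car assms(1) by simp
    hence "u = u'" using e car u u' P_pow_q by metis
    thus "x = x'" using u u' by simp
  qed
  moreover have "(\<lambda>x. x [^] ?d) ` (P #> z) \<subseteq> P"
  proof (rule image_subsetI)
    fix x assume "x \<in> P #> z"
    from rcos_eq[OF assms(1) this] show "x [^] ?d \<in> P"
      by (metis dvd_refl pow_in_P_iff)
  qed
  moreover have "card (P #> z) = card P"
    using card_rcosets_equal[OF rcosetsI[OF P.subset assms(1)] P.subset] by simp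
  ultimately show ?thesis
    unfolding bij_betw_def using card_subset_eq[OF finite_P] by (metis card_image)
qed

text \<open>The coset order \<open>d\<close> is prime to every divisor \<open>e\<close> of
  \<open>q\<close>, so the weight at \<open>d * e\<close> is a weight at \<open>e\<close> with
  parameters \<open>A * d\<close> and \<open>B * totient d\<close>. Summed over \<open>P\<close>, it
  is read again as a weight at \<open>d\<close>.\<close>

lemma sum_P_ord_weight:
  assumes "z \<in> carrier G"
  shows "(\<Sum>u\<in>P. ord_weight A B (quotient_ord z * ord u)) =
    ord_weight (A * ord_sum q) (B * totient_sq_sum q) (quotient_ord z)"
proof -
  let ?d = "quotient_ord z"
  have "ord_weight A B (?d * e) = ord_weight (A * int ?d) (B * int (totient ?d)) e"
    if "e dvd q" for e
  proof -
    have "coprime ?d e" using coprime_quotient_ord[OF assms] that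
      by (meson coprime_divisors dvd_refl)
    thus ?thesis by (simp add: ord_weight_def totient_mult_coprime)
  qed
  hence "(\<Sum>e | e dvd q. int (totient e) * ord_weight A B (?d * e)) =
      (\<Sum>e | e dvd q. int (totient e) * ord_weight (A * int ?d) (B * int (totient ?d)) e)"
    by (intro sum.cong) auto
  thus ?thesis
    using sum_generate_ord[OF fin y_carrier, of "\<lambda>e. ord_weight A B (?d * e)"]
    unfolding ord_y sum_divisors_ord_weight by (simp add: ord_weight_def mult_ac)
qed

lemma coset_sum_central:
  assumes "z \<in> carrier G" "y \<otimes> z = z \<otimes> y"
  shows "(\<Sum>x\<in>P #> z. ord_weight A B (ord x)) =
    ord_weight (A * ord_sum q) (B * totient_sq_sum q) (quotient_ord z)"
proof -
  have "(\<Sum>x\<in>P #> z. ord_weight A B (ord x)) =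
      (\<Sum>x\<in>P #> z. ord_weight A B (quotient_ord z * ord (x [^] quotient_ord z)))"
  proof (rule sum.cong[OF refl])
    fix x assume "x \<in> P #> z"
    from rcos_eq[OF assms(1) this]
    show "ord_weight A B (ord x) = ord_weight A B (quotient_ord z * ord (x [^] quotient_ord z))"
      using ord_eq_quotient_ord_mult[of x] by simp
  qed
  also have "\<dots> = (\<Sum>u\<in>P. ord_weight A B (quotient_ord z * ord u))"
    by (rule sum.reindex_bij_betw[OF bij_betw_pow_coset[OF assms]])
  finally show ?thesis using sum_P_ord_weight[OF assms(1)] by simp
qed

text \<open>A power of \<open>x\<close> generating \<open>P\<close> would force \<open>x\<close> to commute with \<open>y\<close>.\<close>

lemma ord_pow_noncentral:
  assumes "z \<in> carrier G" "y \<otimes> z \<noteq> z \<otimes> y" "x \<in> P #> z" "q = p ^ a" "prime p"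
  shows "p * ord (x [^] quotient_ord z) \<le> q"
proof -
  have x: "x \<in> carrier G" "P #> x = P #> z" using rcos_eq[OF assms(1,3)] by auto
  define v where "v = x [^] quotient_ord z"
  have v: "v \<in> P" unfolding v_def using pow_in_P_iff[OF x(1)] x(2) by simp
  have vc: "v \<in> carrier G" using x(1) by (simp add: v_def)
  obtain u where u: "u \<in> P" "x = u \<otimes> z" using assms(3) by (auto simp: r_coset_def)
  have uc: "u \<in> carrier G" using u P.subset by auto
  have uy: "u \<otimes> y = y \<otimes> u" using commutes_P[OF u(1) y_carrier refl] .
  have xy: "x \<otimes> y \<noteq> y \<otimes> x"
  proof
    assume "x \<otimes> y = y \<otimes> x"
    hence "u \<otimes> (z \<otimes> y) = u \<otimes> (y \<otimes> z)"
      using u uc y_carrier assms(1) uy by (simp flip: m_assoc)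
    thus False using assms(1,2) uc y_carrier by simp
  qed
  have dvd: "ord v dvd p ^ a" using P_pow_q[OF v] pow_eq_id[OF vc] assms(4) by simp
  have "ord v \<noteq> q"
  proof
    assume "ord v = q"
    hence "card (generate G {v}) = card P" using generate_pow_card[OF vc] card_P by simp
    moreover have "generate G {v} \<subseteq> P"
      using v by (intro generate_subgroup_incl P.subgroup_axioms) auto
    ultimately have "generate G {v} = P" using card_subset_eq[OF finite_P] by blast
    moreover have "y \<in> P" by (auto intro: generate.incl)
    ultimately obtain k :: nat where "y = v [^] k"
      using generate_pow_on_finite_carrier[OF fin vc] by blast
    hence "y = x [^] (quotient_ord z * k)" using x(1) by (simp add: v_def nat_pow_pow)
    thus False using xy group_commutes_pow[of x x "quotient_ord z * k"] x(1) by simp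
  qed
  moreover obtain i where i: "i \<le> a" "ord v = p ^ i"
    using dvd divides_primepow_nat[OF assms(5)] by blast
  ultimately have "i \<noteq> a" using assms(4) by blast
  have "p * ord v = p ^ Suc i" using i by simp
  also have "\<dots> \<le> p ^ a" using i \<open>i \<noteq> a\<close> prime_gt_0_nat[OF assms(5)] by (intro power_increasing) auto
  finally show ?thesis using assms(4) by (simp add: v_def)
qed

text \<open>Put \<open>r = q / p\<close>. All orders in the coset are at most \<open>d * r\<close>,
  so the left side is at most \<open>A * d * p * r^2\<close>. On the right, the generators of
  \<open>P\<close> alone contribute at least \<open>A * d * r^2 * (p^2 - 1) / 2\<close>.\<close>

lemma coset_sum_noncentral:
  assumes "z \<in> carrier G" "y \<otimes> z \<noteq> z \<otimes> y" "q = p ^ a" "prime p" "a > 0" "p \<ge> 3"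
    and "0 < A" "0 \<le> B" "2 * B \<le> A"
  shows "(\<Sum>x\<in>P #> z. ord_weight A B (ord x)) <
    ord_weight (A * ord_sum q) (B * totient_sq_sum q) (quotient_ord z)"
proof -
  let ?d = "quotient_ord z"
  define r where "r = p ^ (a - 1)"
  have q: "q = p * r" using assms(3,5) by (cases a) (auto simp: r_def)
  have r: "r > 0" using assms(6) by (simp add: r_def)
  have d: "?d > 0" using quotient_ord_pos[OF assms(1)] .
  have tq: "int (totient q) = int r * (int p - 1)"
    using assms(3-6) by (simp add: totient_prime_power r_def of_nat_diff)
  have le: "int p * ord_weight A B (ord x) \<le> A * int ?d * int q" if "x \<in> P #> z" for x
  proof -
    have x: "x \<in> carrier G" "P #> x = P #> z" using rcos_eq[OF assms(1) that] by auto
    define v where "v = ord (x [^] ?d)"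
    have "p * v \<le> q" using ord_pow_noncentral[OF assms(1,2) that assms(3,4)] by (simp add: v_def)
    hence "int p * int v \<le> int q" by (simp flip: of_nat_mult)
    hence "A * int ?d * (int p * int v) \<le> A * int ?d * int q"
      using assms(7) by (intro mult_left_mono) auto
    moreover have "ord x = ?d * v" using ord_eq_quotient_ord_mult[OF x(1)] x(2) by (simp add: v_def)
    moreover have "0 \<le> int p * (B * int (totient (ord x)))" using assms(8) by simp
    ultimately show ?thesis by (simp add: ord_weight_def algebra_simps)
  qed
  have card: "card (P #> z) = q"
    using card_rcosets_equal[OF rcosetsI[OF P.subset assms(1)] P.subset] card_P by simp
  have "int p * (\<Sum>x\<in>P #> z. ord_weight A B (ord x)) \<le> (\<Sum>x\<in>P #> z. A * int ?d * int q)"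
    unfolding sum_distrib_left by (intro sum_mono le)
  also have "\<dots> = int p * (A * int ?d * int p * (int r)\<^sup>2)"
    by (simp add: card q power2_eq_square)
  finally have upper: "(\<Sum>x\<in>P #> z. ord_weight A B (ord x)) \<le> A * int ?d * int p * (int r)\<^sup>2"
    using assms(6) by simp
  \<comment> \<open>Only the term \<open>e = q\<close> is kept; the others are nonnegative.\<close>
  have "int (totient q) * ord_weight A B (?d * q)
      \<le> (\<Sum>e | e dvd q. int (totient e) * ord_weight A B (?d * e))"
    using q_pos ord_weight_nonneg[OF assms(8,9)]
    by (intro member_le_sum[of q "{e. e dvd q}" "\<lambda>e. int (totient e) * ord_weight A B (?d * e)"])
       simp_all
  also have "\<dots> = (\<Sum>u\<in>P. ord_weight A B (?d * ord u))"
    using sum_generate_ord[OF fin y_carrier, of "\<lambda>e. ord_weight A B (?d * e)"] ord_y by simp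
  also have "\<dots> = ord_weight (A * ord_sum q) (B * totient_sq_sum q) ?d"
    by (rule sum_P_ord_weight[OF assms(1)])
  finally have lower: "int (totient q) * ord_weight A B (?d * q)
      \<le> ord_weight (A * ord_sum q) (B * totient_sq_sum q) ?d" .
  have "2 * (B * int (totient (?d * q))) \<le> A * (int ?d * int (totient q))"
  proof -
    have "totient (?d * q) = totient ?d * totient q"
      by (rule totient_mult_coprime[OF coprime_quotient_ord[OF assms(1)]])
    moreover have "(2 * B) * (int (totient ?d) * int (totient q)) \<le> A * (int ?d * int (totient q))"
      using assms(7-9) by (intro mult_mono) (auto simp: totient_le)
    ultimately show ?thesis by simp
  qed
  moreover have "int q = int p * int r" using q by simp
  hence "A * int ?d * int r * (int p + 1)
      = 2 * (A * int (?d * q)) - A * (int ?d * int (totient q))"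
    by (simp add: tq algebra_simps)
  ultimately have "A * int ?d * int r * (int p + 1) \<le> 2 * ord_weight A B (?d * q)"
    by (simp add: ord_weight_def)
  hence "int (totient q) * (A * int ?d * int r * (int p + 1))
      \<le> int (totient q) * (2 * ord_weight A B (?d * q))"
    by (intro mult_left_mono) auto
  also have "int (totient q) * (A * int ?d * int r * (int p + 1)) =
      A * int ?d * (int r)\<^sup>2 * ((int p)\<^sup>2 - 1)"
    by (simp add: tq algebra_simps power2_eq_square)
  finally have "A * int ?d * (int r)\<^sup>2 * ((int p)\<^sup>2 - 1)
      \<le> 2 * (int (totient q) * ord_weight A B (?d * q))" by simp
  \<comment> \<open>This fails for \<open>p = 2\<close>, which is why that case is settled
    separately by the index of a large cyclic subgroup.\<close>
  moreover have "2 * int p < (int p)\<^sup>2 - 1"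
  proof -
    have "3 * int p \<le> int p * int p" using assms(6) by (intro mult_right_mono) auto
    thus ?thesis unfolding power2_eq_square using assms(6) by linarith
  qed
  hence "A * int ?d * (int r)\<^sup>2 * (2 * int p) < A * int ?d * (int r)\<^sup>2 * ((int p)\<^sup>2 - 1)"
    using assms(7) d r by (intro mult_strict_left_mono) auto
  ultimately have "A * int ?d * int p * (int r)\<^sup>2 < int (totient q) * ord_weight A B (?d * q)"
    by (simp add: mult_ac)
  with upper lower show ?thesis by linarith
qed

end

lemma (in group) sum_ord_weight_cyclic:
  assumes "finite (carrier G)" "g \<in> carrier G" "ord g = order G"
  shows "(\<Sum>x\<in>carrier G. ord_weight A B (ord x)) =
    A * ord_sum (order G) - B * totient_sq_sum (order G)"
proof -
  have "generate G {g} \<subseteq> carrier G" using generate_incl[of "{g}"] assms(2) by simp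
  moreover have "card (generate G {g}) = card (carrier G)"
    using generate_pow_card[OF assms(2)] assms(3) by (simp add: order_def)
  ultimately have "generate G {g} = carrier G" using card_subset_eq[OF assms(1)] by blast
  thus ?thesis
    using sum_generate_ord[OF assms(1,2), of "ord_weight A B"] assms(3) sum_divisors_ord_weight
    by simp
qed

context cyclic_normal_hall_subgroup
begin

lemma sum_carrier_cosets:
  fixes f :: "'a \<Rightarrow> int"
  shows "(\<Sum>x\<in>carrier G. f x) = (\<Sum>K\<in>carrier (G Mod P). \<Sum>x\<in>K. f x)"
proof -
  have cosets: "carrier (G Mod P) = rcosets P" by (simp add: FactGroup_def)
  have disj: "K = L \<or> K \<inter> L = {}" if "K \<in> rcosets P" "L \<in> rcosets P" for K L
    using rcos_disjoint[OF P.subgroup_axioms] that by (auto simp: pairwise_def disjnt_def)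
  have "(\<Sum>x\<in>\<Union>(rcosets P). f x) = (\<Sum>K\<in>rcosets P. \<Sum>x\<in>K. f x)"
    using disj rcosets_finite[OF _ P.subset finite_P]
    by (subst sum.Union_disjoint) (auto simp: o_def)
  thus ?thesis using rcosets_part_G[OF P.subgroup_axioms] cosets by simp
qed

text \<open>The premise \<open>quotient\<close> is the induction hypothesis for
  \<open>G Mod P\<close> at the rescaled weight. Its antecedent holds because no coset sum exceeds
  the rescaled weight of the coset.\<close>

lemma lift_generator:
  assumes "q = p ^ a" "prime p" "a > 0" "p \<ge> 3" "0 < A" "0 \<le> B" "2 * B \<le> A"
    and sum_ge: "A * ord_sum (order G) - B * totient_sq_sum (order G)
           \<le> (\<Sum>x\<in>carrier G. ord_weight A B (ord x))"
    and quotient: "(A * ord_sum q) * ord_sum m - (B * totient_sq_sum q) * totient_sq_sum m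
           \<le> (\<Sum>K\<in>carrier (G Mod P). ord_weight (A * ord_sum q) (B * totient_sq_sum q) (Q.ord K))
         \<Longrightarrow> \<exists>K\<in>carrier (G Mod P). Q.ord K = m"
  shows "\<exists>g\<in>carrier G. ord g = order G"
proof -
  let ?H = "ord_weight (A * ord_sum q) (B * totient_sq_sum q)"
  have "m > 0" using order_quotient finite_quotient Q.order_gt_0_iff_finite by simp
  hence target: "A * ord_sum (order G) - B * totient_sq_sum (order G)
      = (A * ord_sum q) * ord_sum m - (B * totient_sq_sum q) * totient_sq_sum m"
    using coprime_q_m q_pos order_eq
    by (simp add: ord_sum_mult_coprime totient_sq_sum_mult_coprime)
  have le: "(\<Sum>x\<in>K. ord_weight A B (ord x)) \<le> ?H (Q.ord K)" if K: "K \<in> carrier (G Mod P)" for K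
  proof -
    obtain z where "z \<in> carrier G" "K = P #> z" using K by (auto simp: carrier_FactGroup)
    thus ?thesis
      using coset_sum_central coset_sum_noncentral[OF _ _ assms(1-7)]
      by (cases "y \<otimes> z = z \<otimes> y") (auto simp: less_imp_le)
  qed
  have "(\<Sum>x\<in>carrier G. ord_weight A B (ord x)) \<le> (\<Sum>K\<in>carrier (G Mod P). ?H (Q.ord K))"
    unfolding sum_carrier_cosets by (intro sum_mono le)
  then obtain K where K: "K \<in> carrier (G Mod P)" "Q.ord K = m"
    using quotient sum_ge target by auto
  \<comment> \<open>As the quotient is cyclic, its weight sum equals the target value, which leaves
    no room for a strict loss at any coset.\<close>
  have sumQ: "(\<Sum>K\<in>carrier (G Mod P). ?H (Q.ord K)) =
      (A * ord_sum q) * ord_sum m - (B * totient_sq_sum q) * totient_sq_sum m"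
    using Q.sum_ord_weight_cyclic[OF finite_quotient K(1)] K(2) order_quotient by simp
  obtain z where z: "z \<in> carrier G" "K = P #> z" using K(1) by (auto simp: carrier_FactGroup)
  have comm: "y \<otimes> z = z \<otimes> y"
  proof (rule ccontr)
    assume "y \<otimes> z \<noteq> z \<otimes> y"
    hence "(\<Sum>x\<in>K. ord_weight A B (ord x)) < ?H (Q.ord K)"
      using coset_sum_noncentral[OF _ _ assms(1-7)] z by simp
    hence "(\<Sum>x\<in>carrier G. ord_weight A B (ord x)) < (\<Sum>K\<in>carrier (G Mod P). ?H (Q.ord K))"
      unfolding sum_carrier_cosets using le K(1) finite_quotient
      by (intro sum_strict_mono_ex1) auto
    thus False using sum_ge target sumQ by linarith
  qed
  have "y \<in> P" by (auto intro: generate.incl)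
  \<comment> \<open>A root \<open>x\<close> of \<open>y\<close> under the power map has order
    \<open>m * ord y\<close>, which is the order of the group.\<close>
  hence "y \<in> (\<lambda>x. x [^] quotient_ord z) ` (P #> z)"
    using bij_betw_pow_coset[OF z(1) comm] by (simp add: bij_betw_def)
  then obtain x where x: "y = x [^] quotient_ord z" "x \<in> P #> z" by (rule imageE)
  have xc: "x \<in> carrier G" "P #> x = P #> z" using rcos_eq[OF z(1) x(2)] by simp_all
  have "quotient_ord z = m" using K(2) z(2) by simp
  hence "ord x = m * q"
    using ord_eq_quotient_ord_mult[OF xc(1)] unfolding xc(2) x(1)[symmetric] ord_y by simp
  hence "ord x = order G" using order_eq by (simp add: mult.commute)
  thus ?thesis using xc(1) by (rule bexI)
qed

end

section \<open>Maximality of the cyclic group\<close>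

text \<open>All weights are quantified inside, so that the induction hypothesis can be used at
  rescaled parameters. As a property of the group alone it also transports along
  isomorphisms.\<close>

definition cyclic_if_ord_sum_maximal :: "('a, 'b) monoid_scheme \<Rightarrow> bool" where
  "cyclic_if_ord_sum_maximal G \<longleftrightarrow>
    (\<forall>A B. 0 < A \<longrightarrow> 0 \<le> B \<longrightarrow> 2 * B \<le> A \<longrightarrow>
      A * ord_sum (order G) - B * totient_sq_sum (order G)
        \<le> (\<Sum>x\<in>carrier G. ord_weight A B (group.ord G x)) \<longrightarrow>
      (\<exists>g\<in>carrier G. group.ord G g = order G))"

section \<open>Transport along isomorphisms and induction on the order\<close>

lemma ord_iso:
  assumes "group G" "group H" "f \<in> iso G H" "x \<in> carrier G"
  shows "group.ord H (f x) = group.ord G x"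
proof -
  interpret G: group G by fact
  interpret H: group H by fact
  have hom: "f \<in> hom G H" and bij: "bij_betw f (carrier G) (carrier H)"
    using assms(3) by (auto simp: iso_def)
  have fx: "f x \<in> carrier H" using hom assms(4) by (auto simp: hom_def)
  have "f x [^]\<^bsub>H\<^esub> k = \<one>\<^bsub>H\<^esub> \<longleftrightarrow> G.ord x dvd k" for k :: nat
  proof -
    have "f x [^]\<^bsub>H\<^esub> k = f (x [^]\<^bsub>G\<^esub> k)"
      using hom_nat_pow[OF hom assms(4,1,2)] by simp
    moreover have "\<one>\<^bsub>H\<^esub> = f \<one>\<^bsub>G\<^esub>" using hom_one[OF hom assms(1,2)] by simp
    ultimately have "f x [^]\<^bsub>H\<^esub> k = \<one>\<^bsub>H\<^esub> \<longleftrightarrow> x [^]\<^bsub>G\<^esub> k = \<one>\<^bsub>G\<^esub>"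
      using bij assms(4) by (metis G.nat_pow_closed G.one_closed bij_betw_def inj_on_eq_iff)
    thus ?thesis using G.pow_eq_id[OF assms(4)] by simp
  qed
  thus ?thesis using H.ord_unique[OF fx] by blast
qed

lemma cyclic_if_ord_sum_maximal_iso:
  assumes "group G" "group H" "f \<in> iso G H" "cyclic_if_ord_sum_maximal H"
  shows "cyclic_if_ord_sum_maximal G"
proof -
  have bij: "bij_betw f (carrier G) (carrier H)" using assms(3) by (simp add: iso_def)
  have order: "order H = order G" using bij_betw_same_card[OF bij] by (simp add: order_def)
  have "(\<Sum>x\<in>carrier H. ord_weight A B (group.ord H x)) =
      (\<Sum>x\<in>carrier G. ord_weight A B (group.ord G x))" for A B
    using sum.reindex_bij_betw[OF bij, of "\<lambda>x. ord_weight A B (group.ord H x)"]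
      ord_iso[OF assms(1-3)] by simp
  moreover have "(\<exists>h\<in>carrier H. group.ord H h = order H) \<longleftrightarrow>
      (\<exists>g\<in>carrier G. group.ord G g = order G)"
    using bij ord_iso[OF assms(1-3)] order unfolding bij_betw_def by (metis imageE imageI)
  ultimately show ?thesis
    using assms(4) unfolding cyclic_if_ord_sum_maximal_def order by simp
qed

lemma (in group) cyclic_if_ord_sum_maximal_step:
  assumes fin: "finite (carrier G)"
    and IH: "\<And>Q :: 'a set monoid. group Q \<Longrightarrow> finite (carrier Q) \<Longrightarrow> order Q < order G
      \<Longrightarrow> cyclic_if_ord_sum_maximal Q"
  shows "cyclic_if_ord_sum_maximal G"
  unfolding cyclic_if_ord_sum_maximal_def
proof (intro allI impI)
  fix A B :: int
  assume AB: "0 < A" "0 \<le> B" "2 * B \<le> A"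
    and sum_ge: "A * ord_sum (order G) - B * totient_sq_sum (order G)
        \<le> (\<Sum>x\<in>carrier G. ord_weight A B (ord x))"
  have n_pos: "order G > 0" using fin order_gt_0_iff_finite by simp
  show "\<exists>g\<in>carrier G. ord g = order G"
  proof (cases "order G = 1")
    case True
    thus ?thesis using ord_id by (intro bexI[of _ \<one>]) auto
  next
    case False
    hence n: "order G > 1" using n_pos by simp
    define p where "p = Max (prime_factors (order G))"
    have "prime_factors (order G) \<noteq> {}"
      using n by (simp add: prime_factorization_empty_iff)
    hence "p \<in> prime_factors (order G)" unfolding p_def by (intro Max_in) auto
    hence p: "prime p" "p dvd order G" by auto
    have p_max: "r \<le> p" if "prime r" "r dvd order G" for r
      unfolding p_def using that n_pos by (intro Max_ge) (auto simp: prime_factors_dvd)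
    obtain g where g: "g \<in> carrier G" "order G < p * ord g"
      using exists_large_ord[OF fin n p p_max AB sum_ge] by blast
    show ?thesis
    proof (cases "p = 2")
      case True
      obtain i where i: "order G = ord g * i" using ord_dvd_group_order[OF g(1)] by blast
      hence "i < 2" using g(2) True by (simp add: mult.commute)
      moreover have "i \<noteq> 0" using i n_pos by auto
      ultimately have "i = 1" by simp
      thus ?thesis using g(1) i by auto
    next
      case False
      hence p3: "p \<ge> 3" using prime_ge_2_nat[OF p(1)] by simp
      obtain a m where am: "order G = p ^ a * m" "a > 0" "\<not> p dvd m" "coprime (p ^ a) m" "m > 0"
        using prime_power_cofactor[OF p n_pos] .
      obtain y where y: "y \<in> carrier G" "ord y = p ^ a" "generate G {y} \<lhd> G"
        using cyclic_normal_sylow[OF fin p(1) am(1) g] .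
      interpret S: cyclic_normal_hall_subgroup G y "p ^ a" m
        by (intro cyclic_normal_hall_subgroup.intro is_group cyclic_normal_hall_subgroup_axioms.intro)
           (fact fin y am)+
      have "p ^ a > 1" using p3 am(2) by (intro one_less_power) auto
      hence "m < order G" using am by simp
      hence max_Q: "cyclic_if_ord_sum_maximal (G Mod generate G {y})"
        using IH[OF S.Q.is_group S.finite_quotient] S.order_quotient by simp
      have q_pos: "p ^ a > 0" using p3 by simp
      \<comment> \<open>The rescaled parameters stay admissible because
        \<open>totient_sq_sum\<close> is bounded by \<open>ord_sum\<close>.\<close>
      have "(2 * B) * totient_sq_sum (p ^ a) \<le> A * ord_sum (p ^ a)"
        using AB totient_sq_sum_pos[OF q_pos] by (intro mult_mono totient_sq_sum_le_ord_sum) auto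
      moreover have "0 < A * ord_sum (p ^ a)" "0 \<le> B * totient_sq_sum (p ^ a)"
        using AB totient_sq_sum_pos[OF q_pos] ord_sum_pos[OF q_pos] by auto
      ultimately show ?thesis
        using S.lift_generator[OF refl p(1) am(2) p3 AB sum_ge] max_Q
        unfolding cyclic_if_ord_sum_maximal_def S.order_quotient by (simp add: mult.assoc)
    qed
  qed
qed

text \<open>The quotient group lives on the type of sets, so the induction runs over groups on the
  natural numbers and copies each quotient back to that type.\<close>

lemma exists_nat_copy:
  assumes "group Q" "finite (carrier Q)"
  shows "\<exists>(H :: nat monoid) f. group H \<and> f \<in> iso Q H"
proof -
  obtain f :: "_ \<Rightarrow> nat" where "inj_on f (carrier Q)"
    using finite_imp_inj_to_nat_seg[OF assms(2)] by blast
  thus ?thesis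
    using group.inj_imp_image_group_is_group[OF assms(1)] inj_imp_image_group_iso by blast
qed

lemma cyclic_if_ord_sum_maximal_nat:
  fixes G :: "nat monoid"
  assumes "group G" "finite (carrier G)"
  shows "cyclic_if_ord_sum_maximal G"
  using assms
proof (induction "order G" arbitrary: G rule: less_induct)
  case less
  show ?case
  proof (rule group.cyclic_if_ord_sum_maximal_step[OF less.prems])
    fix Q :: "nat set monoid"
    assume Q: "group Q" "finite (carrier Q)" "order Q < order G"
    obtain H :: "nat monoid" and f where H: "group H" "f \<in> iso Q H"
      using exists_nat_copy[OF Q(1,2)] by blast
    have bij: "bij_betw f (carrier Q) (carrier H)" using H(2) by (simp add: iso_def)
    hence "order H = order Q" using bij_betw_same_card by (fastforce simp: order_def)
    moreover have "finite (carrier H)" using bij Q(2) bij_betw_finite by blast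
    ultimately have "cyclic_if_ord_sum_maximal H" using less.hyps[OF _ H(1)] Q(3) by simp
    thus "cyclic_if_ord_sum_maximal Q" by (rule cyclic_if_ord_sum_maximal_iso[OF Q(1) H])
  qed
qed

lemma cyclic_if_ord_sum_maximal:
  assumes "group G" "finite (carrier G)"
  shows "cyclic_if_ord_sum_maximal G"
proof -
  obtain H :: "nat monoid" and f where H: "group H" "f \<in> iso G H"
    using exists_nat_copy[OF assms] by blast
  hence "finite (carrier H)" using assms(2) bij_betw_finite by (auto simp: iso_def)
  thus ?thesis
    using cyclic_if_ord_sum_maximal_iso[OF assms(1) H] cyclic_if_ord_sum_maximal_nat[OF H(1)] by blast
qed

section \<open>Edges of the power graph\<close>

lemma (in group) positive_power_iff:
  assumes "finite (carrier G)" "g \<in> carrier G"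
  shows "is_positive_power G g h \<longleftrightarrow> h \<in> generate G {g}"
  unfolding is_positive_power_def
proof
  assume "\<exists>k::nat. 1 \<le> k \<and> h = g [^] k"
  thus "h \<in> generate G {g}" using generate_pow_on_finite_carrier[OF assms] by blast
next
  assume "h \<in> generate G {g}"
  then obtain k :: nat where "k \<in> {0<..ord g}" "h = g [^] k"
    unfolding generate_eq_image_pow[OF assms] by blast
  thus "\<exists>k::nat. 1 \<le> k \<and> h = g [^] k" by (intro exI[of _ k]) simp
qed

text \<open>The cyclic group of \<open>h\<close> lies in that of \<open>g\<close>, so the two
  coincide exactly if their cardinalities, the orders, agree.\<close>

lemma (in group) mutual_generate_iff:
  assumes "finite (carrier G)" "g \<in> carrier G" "h \<in> generate G {g}"
  shows "g \<in> generate G {h} \<longleftrightarrow> ord h = ord g"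
proof -
  have h: "h \<in> carrier G" using generate_incl[of "{g}"] assms by auto
  have sub: "generate G {h} \<subseteq> generate G {g}"
    using assms by (intro generate_subgroup_incl generate_is_subgroup) auto
  have fin: "finite (generate G {g})"
    using generate_incl[of "{g}"] assms by (auto intro: finite_subset)
  have g_in: "g \<in> generate G {g}" by (auto intro: generate.incl)
  show ?thesis
  proof
    assume "g \<in> generate G {h}"
    hence "generate G {g} \<subseteq> generate G {h}"
      using h by (intro generate_subgroup_incl generate_is_subgroup) auto
    with sub have "generate G {g} = generate G {h}" by blast
    thus "ord h = ord g" using generate_pow_card h assms(2) by simp
  next
    assume "ord h = ord g"
    hence "card (generate G {h}) = card (generate G {g})" using generate_pow_card h assms(2) by simp
    thus "g \<in> generate G {h}" using card_subset_eq[OF fin sub] g_in by simp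
  qed
qed

lemma edge_power_graph_iff:
  "{u, v} \<in> edges (power_graph G) \<longleftrightarrow> u \<in> carrier G \<and> v \<in> carrier G \<and> u \<noteq> v \<and>
     (is_positive_power G u v \<or> is_positive_power G v u)" (is "?L \<longleftrightarrow> ?R")
proof
  assume ?L
  then obtain g h where "{u, v} = {g, h}" "g \<in> carrier G" "h \<in> carrier G" "g \<noteq> h"
    "is_positive_power G g h \<or> is_positive_power G h g"
    unfolding edges_def power_graph_def snd_conv by blast
  thus ?R unfolding doubleton_eq_iff by blast
next
  assume ?R
  thus ?L unfolding edges_def power_graph_def snd_conv by blast
qed

text \<open>Inclusion-exclusion for the relation \<open>R\<close> of pairs with \<open>h\<close> in
  the group of \<open>g\<close>, and its converse. The union consists of the oriented edges
  \<open>D\<close> and the diagonal; the intersection consists of the pairs generating the same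
  subgroup.\<close>

lemma (in group) card_edges_power_graph:
  assumes fin: "finite (carrier G)"
  shows "2 * int (card (edges (power_graph G))) + int (order G) =
    (\<Sum>x\<in>carrier G. ord_weight 2 1 (ord x))"
proof -
  define C where "C = carrier G"
  define N where "N = (\<lambda>g. generate G {g})"
  have fin_C: "finite C" using fin by (simp add: C_def)
  have N_sub: "N g \<subseteq> C" if "g \<in> C" for g
    using generate_incl[of "{g}"] that by (simp add: C_def N_def)
  have N_self: "g \<in> N g" for g by (simp add: N_def generate.incl)
  have power_iff: "is_positive_power G g h \<longleftrightarrow> h \<in> N g" if "g \<in> C" for g h
    using positive_power_iff[OF fin] that by (simp add: C_def N_def)
  have mutual: "g \<in> N h \<longleftrightarrow> ord h = ord g" if "g \<in> C" "h \<in> N g" for g h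
    using mutual_generate_iff[OF fin] that by (simp add: C_def N_def)
  have card_N: "card (N g) = ord g" if "g \<in> C" for g
    using generate_pow_card that by (simp add: C_def N_def)
  have sum_N: "(\<Sum>u\<in>N g. f (ord u)) = (\<Sum>d | d dvd ord g. int (totient d) * f d)"
    if "g \<in> C" for f :: "nat \<Rightarrow> int" and g
    using sum_generate_ord[OF fin] that by (simp add: C_def N_def)
  have fin_N: "finite (N g)" if "g \<in> C" for g using N_sub[OF that] fin_C finite_subset by blast
  define R where "R = (SIGMA g:C. N g)"
  define D where "D = {(g, h). (g, h) \<in> R \<union> R\<inverse> \<and> g \<noteq> h}"
  define E where "E = edges (power_graph G)"
  have R_sub: "R \<subseteq> C \<times> C" unfolding R_def by (intro Sigma_mono N_sub order_refl)
  hence fin_R: "finite R" using fin_C finite_subset by blast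
  moreover have "D \<subseteq> R \<union> R\<inverse>" by (auto simp: D_def)
  ultimately have fin_D: "finite D" using finite_subset by blast
  have D_iff: "(g, h) \<in> D \<longleftrightarrow> {g, h} \<in> E" for g h
  proof (cases "g \<in> C \<and> h \<in> C")
    case True
    thus ?thesis unfolding E_def edge_power_graph_iff
      using power_iff by (auto simp: D_def R_def C_def)
  next
    case False
    thus ?thesis unfolding E_def edge_power_graph_iff using R_sub by (auto simp: D_def C_def)
  qed
  have E_eq: "E = (\<lambda>(g, h). {g, h}) ` D"
  proof (intro equalityI subsetI)
    fix e assume e: "e \<in> E"
    then obtain g h where "e = {g, h}" by (auto simp: E_def edges_def power_graph_def)
    thus "e \<in> (\<lambda>(g, h). {g, h}) ` D" using e D_iff by (intro image_eqI[of _ _ "(g, h)"]) auto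
  qed (use D_iff in auto)
  have fin_E: "finite E" unfolding E_eq using fin_D by simp
  \<comment> \<open>Each edge arises from exactly two ordered pairs.\<close>
  have "card D = (\<Sum>d\<in>D. 1)" by simp
  also have "\<dots> = (\<Sum>e\<in>E. \<Sum>d | d \<in> D \<and> (case d of (g, h) \<Rightarrow> {g, h}) = e. 1)"
    by (rule sum.group[symmetric, OF fin_D fin_E]) (simp add: E_eq)
  also have "\<dots> = (\<Sum>e\<in>E. 2)"
  proof (rule sum.cong[OF refl])
    fix e assume e: "e \<in> E"
    then obtain g h where gh: "(g, h) \<in> D" "e = {g, h}" using E_eq by auto
    have "{d. d \<in> D \<and> (case d of (g, h) \<Rightarrow> {g, h}) = e} = {(g, h), (h, g)}"
      using gh e D_iff by (auto simp: doubleton_eq_iff insert_commute)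
    moreover have "g \<noteq> h" using gh by (simp add: D_def)
    ultimately show "(\<Sum>d | d \<in> D \<and> (case d of (g, h) \<Rightarrow> {g, h}) = e. 1) = 2" by simp
  qed
  finally have card_D: "card D = 2 * card E" by simp
  define I where "I = (\<lambda>g. (g, g)) ` C"
  have card_I: "card I = card C" unfolding I_def by (intro card_image) (simp add: inj_on_def)
  have diag: "R \<union> R\<inverse> = D \<union> I" "D \<inter> I = {}"
    using R_sub N_self by (auto simp: D_def R_def I_def)
  have union: "card (R \<union> R\<inverse>) = card D + card C"
    unfolding diag(1) card_I[symmetric] using fin_D fin_C diag(2)
    by (intro card_Un_disjoint) (auto simp: I_def)
  have "R \<inter> R\<inverse> = (SIGMA g:C. {h \<in> N g. ord h = ord g})"
  proof -
    have "(g, h) \<in> R \<inter> R\<inverse> \<longleftrightarrow> g \<in> C \<and> h \<in> N g \<and> ord h = ord g" for g h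
      using mutual[of g h] N_sub[of g] by (auto simp: R_def)
    thus ?thesis by auto
  qed
  hence "card (R \<inter> R\<inverse>) = (\<Sum>g\<in>C. card {h \<in> N g. ord h = ord g})"
    using fin_C fin_N by simp
  also have "\<dots> = (\<Sum>g\<in>C. totient (ord g))"
  proof (rule sum.cong[OF refl])
    fix g assume g: "g \<in> C"
    have pos: "ord g > 0" using ord_ge_1[OF fin, of g] g by (simp add: C_def)
    \<comment> \<open>The count becomes a sum over orders by taking the indicator of
      \<open>ord g\<close> in \<open>sum_N\<close>.\<close>
    have "int (card {h \<in> N g. ord h = ord g}) = (\<Sum>h\<in>N g. if ord h = ord g then 1 else 0)"
      using fin_N[OF g] by (simp add: sum.If_cases Int_def)
    also have "\<dots> = (\<Sum>d | d dvd ord g. int (totient d) * (if d = ord g then 1 else 0))"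
      by (rule sum_N[OF g])
    also have "\<dots> = int (totient (ord g))"
      using pos by (simp add: if_distrib sum.delta cong: if_cong)
    finally show "card {h \<in> N g. ord h = ord g} = totient (ord g)" by simp
  qed
  finally have inter: "card (R \<inter> R\<inverse>) = (\<Sum>g\<in>C. totient (ord g))" .
  have "card R = (\<Sum>g\<in>C. ord g)" unfolding R_def using fin_C fin_N card_N by simp
  moreover have "card (R \<union> R\<inverse>) + card (R \<inter> R\<inverse>) = card R + card R"
    using card_Un_Int[of R "R\<inverse>"] fin_R by simp
  ultimately have "2 * card E + card C + (\<Sum>g\<in>C. totient (ord g)) = 2 * (\<Sum>g\<in>C. ord g)"
    using union card_D inter by simp
  hence "int (2 * card E + card C + (\<Sum>g\<in>C. totient (ord g))) = int (2 * (\<Sum>g\<in>C. ord g))"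
    by (rule arg_cong)
  hence "2 * int (card E) + int (card C) =
      2 * (\<Sum>g\<in>C. int (ord g)) - (\<Sum>g\<in>C. int (totient (ord g)))"
    by simp
  also have "\<dots> = (\<Sum>g\<in>C. ord_weight 2 1 (ord g))"
    by (simp add: ord_weight_def sum_subtractf sum_distrib_left)
  finally show ?thesis by (simp add: C_def E_def order_def)
qed

section \<open>Isomorphic power graphs, cyclic groups and the final equivalence\<close>

lemma ugraph_iso_power_graph_card:
  assumes "ugraph_iso (power_graph G) (power_graph H)"
  shows "order G = order H" "card (edges (power_graph G)) = card (edges (power_graph H))"
proof -
  obtain f where bij: "bij_betw f (carrier G) (carrier H)"
    and adj: "\<And>u v. u \<in> carrier G \<Longrightarrow> v \<in> carrier G \<Longrightarrow>
      {u, v} \<in> edges (power_graph G) \<longleftrightarrow> {f u, f v} \<in> edges (power_graph H)"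
    using assms unfolding ugraph_iso_def by (auto simp: verts_def power_graph_def)
  show "order G = order H" using bij_betw_same_card[OF bij] by (simp add: order_def)
  have ends_G: "\<exists>u\<in>carrier G. \<exists>v\<in>carrier G. e = {u, v}" if "e \<in> edges (power_graph G)" for e
    using that by (auto simp: edges_def power_graph_def)
  have ends_H: "\<exists>u\<in>carrier H. \<exists>v\<in>carrier H. e = {u, v}" if "e \<in> edges (power_graph H)" for e
    using that by (auto simp: edges_def power_graph_def)
  have "inj_on ((`) f) (Pow (carrier G))"
    using bij by (simp add: bij_betw_def inj_on_image_Pow)
  hence "inj_on ((`) f) (edges (power_graph G))"
    by (rule inj_on_subset) (use ends_G in fastforce)
  moreover have "(`) f ` edges (power_graph G) = edges (power_graph H)"
  proof (intro equalityI subsetI)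
    fix e assume "e \<in> (`) f ` edges (power_graph G)"
    then obtain e' where e': "e' \<in> edges (power_graph G)" "e = f ` e'" by blast
    then obtain u v where "u \<in> carrier G" "v \<in> carrier G" "e' = {u, v}" using ends_G by blast
    thus "e \<in> edges (power_graph H)" using e' adj by simp
  next
    fix e assume e: "e \<in> edges (power_graph H)"
    then obtain u' v' where "u' \<in> carrier H" "v' \<in> carrier H" "e = {u', v'}" using ends_H by blast
    moreover then obtain u v where "u \<in> carrier G" "v \<in> carrier G" "u' = f u" "v' = f v"
      using bij unfolding bij_betw_def by blast
    ultimately have "e = f ` {u, v}" "{u, v} \<in> edges (power_graph G)" using e adj by auto
    thus "e \<in> (`) f ` edges (power_graph G)" by blast
  qed
  ultimately show "card (edges (power_graph G)) = card (edges (power_graph H))"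
    by (metis card_image)
qed

lemma iso_imp_ugraph_iso_power_graph:
  assumes "group G" "group H" "G \<cong> H"
  shows "ugraph_iso (power_graph G) (power_graph H)"
proof -
  obtain f where f: "f \<in> iso G H" using assms(3) by (auto simp: is_iso_def)
  hence hom: "f \<in> hom G H" and bij: "bij_betw f (carrier G) (carrier H)"
    by (auto simp: iso_def)
  interpret G: group G by fact
  have inj: "f u = f v \<longleftrightarrow> u = v" if "u \<in> carrier G" "v \<in> carrier G" for u v
    using inj_on_eq_iff[OF bij_betw_imp_inj_on[OF bij] that] .
  have car: "f u \<in> carrier H" if "u \<in> carrier G" for u using bij that by (auto simp: bij_betw_def)
  have power: "is_positive_power G u v \<longleftrightarrow> is_positive_power H (f u) (f v)"
    if "u \<in> carrier G" "v \<in> carrier G" for u v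
    unfolding is_positive_power_def hom_nat_pow[OF hom that(1) assms(1,2), symmetric]
    using inj that by simp
  have "\<forall>u\<in>carrier G. \<forall>v\<in>carrier G.
      {u, v} \<in> edges (power_graph G) \<longleftrightarrow> {f u, f v} \<in> edges (power_graph H)"
    by (simp add: edge_power_graph_iff inj power car)
  thus ?thesis
    unfolding ugraph_iso_def using bij
    by (intro exI[of _ f]) (simp add: verts_def power_graph_def)
qed

text \<open>The residue \<open>1 mod n\<close> instead of \<open>1\<close> covers \<open>n = 1\<close>, where \<open>1\<close> is not in the carrier.\<close>

lemma integer_mod_group_generator:
  assumes "n \<ge> 1"
  shows "1 mod int n \<in> carrier (integer_mod_group n)"
    and "group.ord (integer_mod_group n) (1 mod int n) = n"
proof -
  show car: "1 mod int n \<in> carrier (integer_mod_group n)"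
    using assms by (simp add: carrier_integer_mod_group)
  have "(1 mod int n) [^]\<^bsub>integer_mod_group n\<^esub> k = \<one>\<^bsub>integer_mod_group n\<^esub> \<longleftrightarrow> n dvd k" for k :: nat
    by (simp add: mod_mult_right_eq) (simp flip: zmod_int add: mod_eq_0_iff_dvd)
  thus "group.ord (integer_mod_group n) (1 mod int n) = n"
    using group.ord_unique[OF group_integer_mod_group car] by blast
qed

lemma order_integer_mod_group: "n \<ge> 1 \<Longrightarrow> order (integer_mod_group n) = n"
  by (simp add: order_def carrier_integer_mod_group)

lemma (in group) iso_integer_mod_group:
  assumes "n \<ge> 1" "g \<in> carrier G" "ord g = n" "order G = n"
  shows "G \<cong> integer_mod_group n"
proof -
  have fin: "finite (carrier G)" using assms order_gt_0_iff_finite by simp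
  have carrier: "carrier (integer_mod_group n) = {0..<int n}"
    using assms(1) by (simp add: carrier_integer_mod_group)
  have inj: "inj_on (\<lambda>k::int. g [^] k) {0..<int n}"
  proof (rule inj_onI)
    fix i j assume ij: "i \<in> {0..<int n}" "j \<in> {0..<int n}" "g [^] i = g [^] j"
    hence "int n dvd j - i" using int_pow_eq[OF assms(2)] assms(3) by simp
    hence "j mod int n = i mod int n" by (simp add: mod_eq_dvd_iff)
    thus "i = j" using ij by simp
  qed
  have "(\<lambda>k::int. g [^] k) ` {0..<int n} = carrier G"
    using assms(2,4) inj by (intro card_subset_eq[OF fin]) (auto simp: card_image order_def)
  moreover have "(\<lambda>k::int. g [^] k) \<in> hom (integer_mod_group n) G"
  proof (rule homI)
    fix i j assume "i \<in> carrier (integer_mod_group n)" "j \<in> carrier (integer_mod_group n)"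
    \<comment> \<open>The operation of \<open>integer_mod_group n\<close> reduces modulo
      \<open>n\<close>; this does not affect powers of an element of order \<open>n\<close>.\<close>
    have "int (ord g) dvd (i + j) - (i + j) mod int n"
      using assms(3) by (simp add: minus_mod_eq_mult_div)
    hence "g [^] ((i + j) mod int n) = g [^] (i + j)" using int_pow_eq[OF assms(2)] by blast
    thus "g [^] (i \<otimes>\<^bsub>integer_mod_group n\<^esub> j) = g [^] i \<otimes> g [^] j"
      using assms(2) by (simp add: int_pow_mult)
  qed (use assms(2) in simp)
  ultimately have "(\<lambda>k::int. g [^] k) \<in> iso (integer_mod_group n) G"
    using inj by (simp add: iso_def bij_betw_def carrier)
  hence "integer_mod_group n \<cong> G" by (auto simp: is_iso_def)
  thus ?thesis using group.iso_sym[OF group_integer_mod_group] by blast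
qed

text \<open>Equal orders and edge counts give equal weight sums for \<open>A = 2\<close>,
  \<open>B = 1\<close>, so the maximality criterion applies with equality.\<close>

lemma (in group) iso_integer_mod_group_if_card_edges:
  assumes "finite (carrier G)" "n \<ge> 1" "order G = n"
    and "card (edges (power_graph G)) = card (edges (power_graph (integer_mod_group n)))"
  shows "G \<cong> integer_mod_group n"
proof -
  interpret Z: group "integer_mod_group n" by simp
  have fin_Z: "finite (carrier (integer_mod_group n))"
    using assms(2) by (simp add: carrier_integer_mod_group)
  have "(\<Sum>x\<in>carrier G. ord_weight 2 1 (ord x)) = 2 * ord_sum n - 1 * totient_sq_sum n"
    using card_edges_power_graph[OF assms(1)] Z.card_edges_power_graph[OF fin_Z] assms(3,4)
      Z.sum_ord_weight_cyclic[OF fin_Z integer_mod_group_generator(1)[OF assms(2)], of 2 1]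
      integer_mod_group_generator(2)[OF assms(2)] order_integer_mod_group[OF assms(2)] by simp
  then obtain g where "g \<in> carrier G" "ord g = order G"
    using cyclic_if_ord_sum_maximal[OF is_group assms(1)] assms(3)
    unfolding cyclic_if_ord_sum_maximal_def
    by (metis order_refl zero_le_one zero_less_numeral mult.right_neutral)
  thus ?thesis using iso_integer_mod_group[OF assms(2)] assms(3) by simp
qed

text \<open>Edge counts are compared at equal order: the Klein four-group and the cyclic group of
  order 3 both have three edges.\<close>

theorem corollary1p4:
  fixes G :: "('a, 'b) monoid_scheme" and n :: nat
  assumes "group G" and "finite (carrier G)" and "n \<ge> 1"
  shows "(ugraph_iso (power_graph G) (power_graph (integer_mod_group n)) \<longleftrightarrow>
            G \<cong> integer_mod_group n) \<and>
         (order G = n \<longrightarrow>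
            (card (edges (power_graph G)) = card (edges (power_graph (integer_mod_group n))) \<longleftrightarrow>
             G \<cong> integer_mod_group n))"
proof -
  interpret group G by fact
  have "G \<cong> integer_mod_group n"
    if "ugraph_iso (power_graph G) (power_graph (integer_mod_group n))"
    using ugraph_iso_power_graph_card[OF that] assms(2,3) order_integer_mod_group
    by (intro iso_integer_mod_group_if_card_edges) auto
  moreover have "ugraph_iso (power_graph G) (power_graph (integer_mod_group n))"
    if "G \<cong> integer_mod_group n"
    using that assms(1) by (intro iso_imp_ugraph_iso_power_graph) auto
  ultimately show ?thesis
    using iso_integer_mod_group_if_card_edges[OF assms(2,3)] ugraph_iso_power_graph_card(2) by blast
qed

end
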